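(* Let $G=K_{a,b,b,b}$ with $a,b\ge 1$, and let $\phi(x,y)=xy$ be the second Zagreb weight. Then the corresponding weighted adjacency matrix $M2(G)$ has exactly three distinct eigenvalues if and only if $a=b$ or $a=4b$. For the irregular family $K_{4b,b,b,b}$, $$\operatorname{Spec}(M2(K_{4b,b,b,b}))=\{0^{[7b-4]},\,108b^3,\,(-36b^3)^{[3]}\}.$$
   Context: $K_{a,b,b,b}$ is the complete $4$-partite graph with part sizes $a,b,b,b$ (positive integers): its vertex set is partitioned into four independent sets of these sizes, and any two vertices from different parts are adjacent. For a finite simple graph $G$ with vertices $v_1,\dots,v_n$ of degrees $d_1,\dots,d_n$ and a symmetric function $\phi$, the degree-based weighted adjacency matrix is the $n\times n$ real symmetric matrix whose $(i,j)$ entry is $\phi(d_i,d_j)$ if $v_i$ and $v_j$ are adjacent, and $0$ otherwise; for $\phi(x,y)=xy$ it is denoted $M2(G)$. $\operatorname{Spec}(M)$ is the multiset of eigenvalues of $M$; $\lambda^{[k]}$ means $\lambda$ repeated with multiplicity $k$.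
   Formalization: The equivalence is stated for all a,b ≥ 1 except a=b=1, where it fails: G is then K_4 and M2(G) has only the two distinct eigenvalues 27 and -9 although a=b. *)

theory Defs
  imports
    "Graph_Theory.Digraph"
    "Jordan_Normal_Form.Spectral_Radius"
    "HOL-Computational_Algebra.Polynomial"
    "HOL-Library.Disjoint_Sets"
begin

text \<open>
  As in \<open>complete_bipartite_digraph\<close> of the \<open>Graph_Theory\<close> entry, a finite simple graph is a
  finite symmetric digraph without loops and without parallel arcs (locale \<^locale>\<open>graph\<close>); each
  undirected edge is a pair of opposite arcs. Hence the degree of a vertex is its out-degree.
\<close>

text \<open>
  \<open>P i\<close> is the \<open>i\<close>-th part; the list \<open>ns\<close> gives the part sizes.
\<close>
definition complete_multipartite_digraph :: "nat list \<Rightarrow> ('a, 'b) pre_digraph \<Rightarrow> bool" where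
  "complete_multipartite_digraph ns G \<longleftrightarrow> graph G \<and>
     (\<exists>P. disjoint_family_on P {..<length ns} \<and>
          verts G = (\<Union>i<length ns. P i) \<and>
          (\<forall>i<length ns. card (P i) = ns ! i) \<and>
          arcs_ends G = {(u, v). \<exists>i<length ns. \<exists>j<length ns. i \<noteq> j \<and> u \<in> P i \<and> v \<in> P j})"

lemma complete_multipartite_digraph_exists:
  "\<exists>G :: (nat \<times> nat, (nat \<times> nat) \<times> (nat \<times> nat)) pre_digraph.
     complete_multipartite_digraph ns G"
proof -
  define P where "P i = {i} \<times> {..<ns ! i}" for i
  define V where "V = (\<Union>i<length ns. P i)"
  define E where
    "E = {(u, v). \<exists>i<length ns. \<exists>j<length ns. i \<noteq> j \<and> u \<in> P i \<and> v \<in> P j}"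
  define G where "G = \<lparr> verts = V, arcs = E, tail = fst, head = snd \<rparr>"
  have E: "E \<subseteq> V \<times> V" and finV: "finite V"
    unfolding E_def V_def P_def by auto
  hence finE: "finite E"
    by (meson finite_SigmaI finite_subset)
  have ends: "arcs_ends G = E"
    by (auto simp: arcs_ends_def arc_to_ends_def G_def)
  have "sym E"
    unfolding sym_def E_def by fast
  moreover have "u \<noteq> v" if "(u, v) \<in> E" for u v
    using that unfolding E_def P_def by auto
  ultimately have "graph G"
    using E finV finE ends
    by unfold_locales (auto simp: G_def arc_to_ends_def symmetric_def)
  moreover have "disjoint_family_on P {..<length ns}"
    by (auto simp: disjoint_family_on_def P_def)
  ultimately show ?thesis
    unfolding complete_multipartite_digraph_def
    by (intro exI[of _ G] conjI exI[of _ P])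
       (use ends in \<open>auto simp: G_def V_def E_def P_def card_cartesian_product\<close>)
qed

text \<open>
  The list \<open>vs\<close> is the enumeration \<open>v\<^sub>1, \<dots>, v\<^sub>n\<close> of the vertices; it is meant to satisfy
  \<open>distinct vs\<close> and \<open>set vs = verts G\<close>.
\<close>
definition weighted_adj_mat ::
  "(real \<Rightarrow> real \<Rightarrow> real) \<Rightarrow> ('a, 'b) pre_digraph \<Rightarrow> 'a list \<Rightarrow> real mat" where
  "weighted_adj_mat \<phi> G vs = mat (length vs) (length vs) (\<lambda>(i, j).
     if (vs ! i, vs ! j) \<in> arcs_ends G
     then \<phi> (real (out_degree G (vs ! i))) (real (out_degree G (vs ! j))) else 0)"

definition M2 :: "('a, 'b) pre_digraph \<Rightarrow> 'a list \<Rightarrow> real mat" where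
  "M2 = weighted_adj_mat (\<lambda>x y. x * y)"

text \<open>
  The multiset of real roots of the characteristic polynomial. For the real symmetric matrices
  considered here all roots are real, and algebraic and geometric multiplicities agree.
\<close>
definition Spec :: "real mat \<Rightarrow> real multiset" where
  "Spec A = proots (char_poly A)"

end

theory Submission
  imports Defs
begin

text \<open>
  Let \<open>w v\<close> be the degree of the vertex \<open>v\<close> and \<open>p v\<close> the part that contains it. The entry of the
  matrix at \<open>(u, v)\<close> is \<open>w u * w v\<close> if \<open>p u \<noteq> p v\<close> and \<open>0\<close> otherwise, so the matrix factors as \<open>U * V\<close>
  through a space with one dimension per part. As \<open>U * V\<close> and \<open>V * U\<close> have the same characteristic
  polynomial up to a power of \<open>X\<close> (\<open>char_poly_mult_commute\<close>), all eigenvalues apart from zeros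
  come from the small matrix \<open>V * U\<close>. Its entry at \<open>(i, j)\<close>, \<open>i \<noteq> j\<close>, is the mass of part \<open>j\<close>, the sum of
  the squared degrees of its vertices (\<open>char_poly_complete_multipartite\<close>).

  In \<open>K\<^bsub>a,b,b,b\<^esub>\<close> the degrees are \<open>3b\<close> and \<open>a + 2b\<close>, so the masses are \<open>s = 9ab\<^sup>2\<close> for the first part and
  \<open>t = b(a + 2b)\<^sup>2\<close> for each of the other three. The determinant of size four
  (\<open>det_four_eq_off_diagonal_columns\<close>) gives the characteristic polynomial
  \<open>X\<^bsup>a + 3b - 4\<^esup> (X + t)\<^sup>2 (X\<^sup>2 - 2tX - 3st)\<close>. Its quadratic factor has one root above \<open>2t\<close> and one
  negative root. For \<open>a + 3b > 4\<close> the number \<open>0\<close> is an eigenvalue as well, and there are exactly three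
  eigenvalues iff the negative root is \<open>-t\<close>, that is, iff \<open>s = t\<close>
  (\<open>card_zero_and_quadratic_roots\<close>). As \<open>s - t = -b(a - b)(a - 4b)\<close>, this means \<open>a = b\<close> or \<open>a = 4b\<close>.
  When \<open>s = t\<close>, the quadratic factor is \<open>(X + t)(X - 3t)\<close>, and \<open>t = 36b\<^sup>3\<close> for \<open>a = 4b\<close>.
\<close>

section \<open>Determinants and characteristic polynomials\<close>

lemma det_four_eq_off_diagonal_columns:
  fixes x s t :: "'a :: idom"
  shows "det (mat 4 4 (\<lambda>(i, j). if i = j then x else if j = 0 then - s else - t))
         = (x + t)\<^sup>2 * (x\<^sup>2 - 2 * t * x - 3 * s * t)"
proof -
  let ?M = "mat 4 4 (\<lambda>(i, j). if i = j then x else if j = 0 then - s else - t)"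
  have L: "det A = (\<Sum>j<Suc n. A $$ (0, j) * ((-1) ^ j * det (mat_delete A 0 j)))"
    if "A \<in> carrier_mat (Suc n) (Suc n)" for A :: "'a mat" and n
    using laplace_expansion_row[OF that, of 0] by (simp add: cofactor_def)
  \<comment> \<open>The minors are expanded as matrices of size three in general, since \<^const>\<open>mat_delete\<close>
      does not preserve the shape of \<open>?M\<close>.\<close>
  have D3: "det A = A $$ (0,0) * (A $$ (1,1) * A $$ (2,2) - A $$ (1,2) * A $$ (2,1))
     - A $$ (0,1) * (A $$ (1,0) * A $$ (2,2) - A $$ (1,2) * A $$ (2,0))
     + A $$ (0,2) * (A $$ (1,0) * A $$ (2,1) - A $$ (1,1) * A $$ (2,0))"
    if A: "A \<in> carrier_mat 3 3" for A :: "'a mat"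
  proof -
    have 2: "det B = B $$ (0,0) * B $$ (1,1) - B $$ (0,1) * B $$ (1,0)"
      if B: "B \<in> carrier_mat 2 2" for B :: "'a mat"
    proof -
      have "det (mat_delete B 0 j) = mat_delete B 0 j $$ (0, 0)" for j
        using mat_delete_carrier[OF B, of 0 j] by (intro det_single) simp
      then show ?thesis
        using B by (subst L[of _ 1]) (auto simp: numeral_2_eq_2 mat_delete_def)
    qed
    have *: "mat_delete A 0 j \<in> carrier_mat 2 2" for j
      using mat_delete_carrier[OF A, of 0 j] by simp
    have "det A = (\<Sum>j<Suc 2. A $$ (0, j) * ((-1) ^ j * det (mat_delete A 0 j)))"
      using A by (intro L) simp
    then show ?thesis
      unfolding 2[OF *] using A
      by (simp add: mat_delete_def lessThan_Suc numeral_3_eq_3 numeral_2_eq_2 algebra_simps)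
  qed
  have *: "mat_delete ?M 0 j \<in> carrier_mat 3 3" for j
    using mat_delete_carrier[of ?M 4 4 0 j] by simp
  have sum4: "(\<Sum>j<Suc 3. f j) = f 0 + f 1 + f 2 + f 3" for f :: "nat \<Rightarrow> 'a"
    by (simp add: eval_nat_numeral)
  have "det ?M = (\<Sum>j<Suc 3. ?M $$ (0, j) * ((-1) ^ j * det (mat_delete ?M 0 j)))"
    by (rule L) auto
  also have "\<dots> = (x + t)\<^sup>2 * (x\<^sup>2 - 2 * t * x - 3 * s * t)"
    unfolding D3[OF *] sum4
    by (simp add: mat_delete_def) (simp add: algebra_simps power2_eq_square)
  finally show ?thesis .
qed

text \<open>
  The block matrices \<open>L\<close> and \<open>R\<close>, with rows \<open>(U * V, 0)\<close>, \<open>(V, 0)\<close> and \<open>(0, 0)\<close>, \<open>(V, V * U)\<close>, are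
  conjugate by the unipotent matrix \<open>P\<close>. Both are block triangular, so comparing their
  characteristic polynomials gives the identity.
\<close>
lemma char_poly_mult_commute:
  fixes U V :: "'a :: idom mat"
  assumes U: "U \<in> carrier_mat n k" and V: "V \<in> carrier_mat k n"
  shows "char_poly (U * V) * [:0, 1:] ^ k = [:0, 1:] ^ n * char_poly (V * U)"
proof -
  have UV: "U * V \<in> carrier_mat n n" and VU: "V * U \<in> carrier_mat k k" using U V by auto
  let ?cm = char_poly_matrix
  have cp0: "char_poly (0\<^sub>m m m :: 'a mat) = [:0, 1:] ^ m" for m
  proof -
    have "diag_mat (0\<^sub>m m m :: 'a mat) = replicate m 0"
      unfolding diag_mat_def by (rule nth_equalityI) auto
    then show ?thesis
      using char_poly_upper_triangular[of "0\<^sub>m m m :: 'a mat" m] by (simp add: upper_triangular_def)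
  qed
  define L where "L = four_block_mat (U * V) (0\<^sub>m n k) V (0\<^sub>m k k)"
  define R where "R = four_block_mat (0\<^sub>m n n) (0\<^sub>m n k) V (V * U)"
  define P where "P = four_block_mat (1\<^sub>m n) U (0\<^sub>m k n) (1\<^sub>m k)"
  define Q where "Q = four_block_mat (1\<^sub>m n) (- U) (0\<^sub>m k n) (1\<^sub>m k)"
  have carr: "{L, R, P, Q} \<subseteq> carrier_mat (n + k) (n + k)"
    unfolding L_def R_def P_def Q_def using U V by auto
  have PQ: "P * Q = 1\<^sub>m (n + k)"
    unfolding P_def Q_def using U
    by (subst mult_four_block_mat[of _ n n _ k _ k _ _ n _ k])
       (auto simp: uminus_l_inv_mat four_block_one_mat[symmetric] simp del: four_block_one_mat)
  have QP: "Q * P = 1\<^sub>m (n + k)"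
    unfolding P_def Q_def using U
    by (subst mult_four_block_mat[of _ n n _ k _ k _ _ n _ k])
       (auto simp: comm_add_mat[of U n k "- U"] four_block_one_mat[symmetric] simp del: four_block_one_mat)
  have LP: "L * P = P * R"
    unfolding P_def R_def L_def using U V
    by (simp add: mult_four_block_mat[of _ n n _ k _ k _ _ n _ k] assoc_mult_mat[of U n k V n U k])
  have "L = L * (P * Q)" using carr right_mult_one_mat[of L "n + k" "n + k"] unfolding PQ by simp
  also have "\<dots> = P * R * Q" using carr LP by (simp flip: assoc_mult_mat[of _ "n+k" "n+k" _ "n+k" _ "n+k"])
  finally have "similar_mat L R" by (intro similar_matI[OF carr PQ QP])
  then have "char_poly L = char_poly R" by (rule char_poly_similar)
  moreover have blk: "char_poly (four_block_mat A (0\<^sub>m n k) C D) = char_poly A * char_poly D"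
    if "A \<in> carrier_mat n n" "C \<in> carrier_mat k n" "D \<in> carrier_mat k k" for A C D :: "'a mat"
  proof -
    have "?cm (four_block_mat A (0\<^sub>m n k) C D)
       = four_block_mat (?cm A) (0\<^sub>m n k) (map_mat (\<lambda>a. [:- a:]) C) (?cm D)"
      by (rule eq_matI) (use that in \<open>auto simp: char_poly_matrix_def one_poly_def\<close>)
    then show ?thesis
      unfolding char_poly_def
      using that by (simp add: det_four_block_mat_upper_right_zero[of _ n _ k])
  qed
  ultimately show ?thesis
    unfolding L_def R_def using UV VU V by (simp add: cp0)
qed

section \<open>Reduction to the matrix of part masses\<close>

text \<open>
  The matrix is \<open>U * V\<close>, where row \<open>u\<close> of \<open>U\<close> is \<open>w u\<close> times the unit vector of the class \<open>p u\<close>, and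
  row \<open>i\<close> of \<open>V\<close> lists the weights of the elements outside class \<open>i\<close>.
\<close>
lemma char_poly_complete_multipartite:
  fixes w :: "nat \<Rightarrow> 'a :: idom" and p :: "nat \<Rightarrow> nat"
  assumes p: "\<And>u. u < n \<Longrightarrow> p u < k"
  shows "char_poly (mat n n (\<lambda>(u, v). if p u \<noteq> p v then w u * w v else 0)) * [:0, 1:] ^ k
       = [:0, 1:] ^ n *
         char_poly (mat k k (\<lambda>(i, j). if i \<noteq> j then \<Sum>v | v < n \<and> p v = j. (w v)\<^sup>2 else 0))"
proof -
  define U where "U = mat n k (\<lambda>(u, i). if p u = i then w u else 0)"
  define V where "V = mat k n (\<lambda>(i, v). if p v \<noteq> i then w v else 0)"
  have "U * V = mat n n (\<lambda>(u, v). if p u \<noteq> p v then w u * w v else 0)"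
    unfolding U_def V_def
    by (rule eq_matI) (auto simp: scalar_prod_def if_distrib[of "\<lambda>x. x * _"] p cong: if_cong)
  moreover have "V * U
      = mat k k (\<lambda>(i, j). if i \<noteq> j then \<Sum>v | v < n \<and> p v = j. (w v)\<^sup>2 else 0)"
    unfolding U_def V_def
    by (rule eq_matI)
       (auto simp: scalar_prod_def power2_eq_square split: if_splits
             intro!: sum.neutral sum.mono_neutral_cong_right)
  ultimately show ?thesis
    using char_poly_mult_commute[of U n k V] by (simp add: U_def V_def)
qed

lemma (in nomulti_digraph) out_degree_eq_card_successors:
  "out_degree G u = card {v. (u, v) \<in> arcs_ends G}"
proof -
  have "inj_on (head G) (out_arcs G u)"
    by (rule inj_onI) (auto intro!: no_multi_arcs simp: arc_to_ends_def)
  moreover have "head G ` out_arcs G u = {v. (u, v) \<in> arcs_ends G}"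
    by (auto simp: arcs_ends_def arc_to_ends_def)
  ultimately show ?thesis
    unfolding out_degree_def by (metis card_image)
qed

text \<open>
  The colouring \<open>p\<close> replaces the parts, which are sets of vertices, by classes of positions in the
  enumeration \<open>vs\<close>; these positions index the rows of the matrix.
\<close>
lemma complete_multipartite_enumeration:
  assumes G: "complete_multipartite_digraph ns G"
    and vs: "distinct vs" "set vs = verts G"
  obtains p where
    "\<And>u. u < length vs \<Longrightarrow> p u < length ns"
    "\<And>u v. u < length vs \<Longrightarrow> v < length vs \<Longrightarrow> (vs ! u, vs ! v) \<in> arcs_ends G \<longleftrightarrow> p u \<noteq> p v"
    "\<And>i. i < length ns \<Longrightarrow> card {v. v < length vs \<and> p v = i} = ns ! i"
    "\<And>u. u < length vs \<Longrightarrow> out_degree G (vs ! u) = length vs - ns ! p u"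
    "length vs = sum_list ns"
proof -
  let ?n = "length vs" and ?k = "length ns"
  from G obtain P where gr: "graph G"
    and disj: "disjoint_family_on P {..<?k}"
    and V: "verts G = (\<Union>i<?k. P i)"
    and card: "\<And>i. i < ?k \<Longrightarrow> card (P i) = ns ! i"
    and E: "arcs_ends G = {(u, v). \<exists>i<?k. \<exists>j<?k. i \<noteq> j \<and> u \<in> P i \<and> v \<in> P j}"
    unfolding complete_multipartite_digraph_def by auto
  have uniq: "i = j" if "i < ?k" "j < ?k" "x \<in> P i" "x \<in> P j" for i j x
    using disj that by (auto simp: disjoint_family_on_def)
  have "\<forall>u\<in>{..<?n}. \<exists>i. i < ?k \<and> vs ! u \<in> P i"
    using vs(2) V nth_mem by fastforce
  then obtain p where p: "\<And>u. u < ?n \<Longrightarrow> p u < ?k \<and> vs ! u \<in> P (p u)"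
    by (metis lessThan_iff)
  have inj: "inj_on ((!) vs) A" if "A \<subseteq> {..<?n}" for A
    using vs(1) that by (auto simp: inj_on_def nth_eq_iff_index_eq subset_iff)
  have edge: "(vs ! u, vs ! v) \<in> arcs_ends G \<longleftrightarrow> p u \<noteq> p v" if "u < ?n" "v < ?n" for u v
    using p[OF that(1)] p[OF that(2)] unfolding E by (auto dest: uniq)
  have cls: "card {v. v < ?n \<and> p v = i} = ns ! i" if i: "i < ?k" for i
  proof -
    have "P i \<subseteq> (!) vs ` {v. v < ?n \<and> p v = i}"
    proof
      fix x assume x: "x \<in> P i"
      then have "x \<in> set vs" using vs(2) V i by auto
      then obtain v where "v < ?n" "x = vs ! v" by (auto simp: in_set_conv_nth)
      then show "x \<in> (!) vs ` {v. v < ?n \<and> p v = i}" using p[of v] uniq[of i "p v" x] x i by auto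
    qed
    then have "(!) vs ` {v. v < ?n \<and> p v = i} = P i"
      using p by auto
    then show ?thesis
      using card_image[OF inj[of "{v. v < ?n \<and> p v = i}"]] card[OF i] by fastforce
  qed
  have deg: "out_degree G (vs ! u) = ?n - ns ! p u" if u: "u < ?n" for u
  proof -
    have nm: "nomulti_digraph G" using gr by (simp add: graph_def digraph_def)
    have "{x. (vs ! u, x) \<in> arcs_ends G} = (!) vs ` ({..<?n} - {v. v < ?n \<and> p v = p u})"
    proof (intro subset_antisym subsetI)
      fix x assume x: "x \<in> {x. (vs ! u, x) \<in> arcs_ends G}"
      then have "x \<in> set vs" unfolding vs(2) V E by blast
      then obtain v where "v < ?n" "x = vs ! v" by (auto simp: in_set_conv_nth)
      then show "x \<in> (!) vs ` ({..<?n} - {v. v < ?n \<and> p v = p u})" using x edge[OF u, of v] by auto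
    next
      fix x assume "x \<in> (!) vs ` ({..<?n} - {v. v < ?n \<and> p v = p u})"
      then show "x \<in> {x. (vs ! u, x) \<in> arcs_ends G}" using edge[OF u] by fastforce
    qed
    then have "out_degree G (vs ! u) = card ({..<?n} - {v. v < ?n \<and> p v = p u})"
      unfolding nomulti_digraph.out_degree_eq_card_successors[OF nm] by (simp add: card_image inj)
    also have "\<dots> = ?n - ns ! p u"
      using cls[of "p u"] p[OF u] by (subst card_Diff_subset) auto
    finally show ?thesis .
  qed
  have "sum_list ns = (\<Sum>i<?k. card {v \<in> {..<?n}. p v = i})"
    using cls by (simp add: sum_list_sum_nth atLeast0LessThan)
  also have "\<dots> = ?n"
    using sum.group[of "{..<?n}" "{..<?k}" p "\<lambda>_. 1 :: nat"] p by auto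
  finally have "?n = sum_list ns" by simp
  then show ?thesis
    by (intro that[of p]) (use p edge cls deg in auto)
qed

lemma char_poly_M2_complete_multipartite:
  assumes G: "complete_multipartite_digraph ns G"
    and vs: "distinct vs" "set vs = verts G"
  shows "char_poly (M2 G vs) * [:0, 1:] ^ length ns
       = [:0, 1:] ^ sum_list ns *
         char_poly (mat (length ns) (length ns) (\<lambda>(i, j).
           if i \<noteq> j then real (ns ! j) * (real (sum_list ns - ns ! j))\<^sup>2 else 0))"
proof -
  let ?k = "length ns" and ?n = "length vs"
  obtain p where p: "\<And>u. u < ?n \<Longrightarrow> p u < ?k"
    and edge: "\<And>u v. u < ?n \<Longrightarrow> v < ?n \<Longrightarrow> (vs ! u, vs ! v) \<in> arcs_ends G \<longleftrightarrow> p u \<noteq> p v"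
    and cls: "\<And>i. i < ?k \<Longrightarrow> card {v. v < ?n \<and> p v = i} = ns ! i"
    and deg: "\<And>u. u < ?n \<Longrightarrow> out_degree G (vs ! u) = ?n - ns ! p u"
    and n: "?n = sum_list ns"
    using complete_multipartite_enumeration[OF G vs] by blast
  define w where "w u = real (?n - ns ! p u)" for u
  have "M2 G vs = mat ?n ?n (\<lambda>(u, v). if p u \<noteq> p v then w u * w v else 0)"
    unfolding M2_def weighted_adj_mat_def w_def
    by (rule cong_mat) (auto simp: edge deg)
  moreover have "(\<Sum>v | v < ?n \<and> p v = j. (w v)\<^sup>2) = real (ns ! j) * (real (?n - ns ! j))\<^sup>2"
    if "j < ?k" for j
    using cls[OF that] by (simp add: w_def)
  then have "mat ?k ?k (\<lambda>(i, j). if i \<noteq> j then \<Sum>v | v < ?n \<and> p v = j. (w v)\<^sup>2 else 0)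
      = mat ?k ?k (\<lambda>(i, j). if i \<noteq> j then real (ns ! j) * (real (?n - ns ! j))\<^sup>2 else 0)"
    by (intro cong_mat) auto
  ultimately show ?thesis
    using char_poly_complete_multipartite[of ?n p ?k w] p unfolding n[symmetric] by simp
qed

section \<open>Three parts of equal size\<close>

lemma char_poly_M2_one_part_and_three_equal:
  fixes a b :: nat
  assumes a: "a \<ge> 1" and b: "b \<ge> 1"
    and G: "complete_multipartite_digraph [a, b, b, b] G"
    and vs: "distinct vs" "set vs = verts G"
  defines "s \<equiv> 9 * real a * (real b)\<^sup>2" and "t \<equiv> real b * (real a + 2 * real b)\<^sup>2"
  shows "char_poly (M2 G vs)
       = [:0, 1:] ^ (a + 3 * b - 4) * ([:t, 1:]\<^sup>2 * [:- 3 * s * t, - 2 * t, 1:])"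
proof -
  let ?ns = "[a, b, b, b]"
  let ?Q = "mat 4 4 (\<lambda>(i, j). if i \<noteq> j then real (?ns ! j) * (real (a + 3 * b - ?ns ! j))\<^sup>2 else 0)"
  have col: "real (?ns ! j) * (real (a + 3 * b - ?ns ! j))\<^sup>2 = (if j = 0 then s else t)" if "j < 4" for j
  proof -
    from that consider "j = 0" | "j = 1" | "j = 2" | "j = 3" by linarith
    then show ?thesis
      by cases (simp_all add: s_def t_def power2_eq_square algebra_simps)
  qed
  have "char_poly_matrix ?Q = mat 4 4 (\<lambda>(i, j). if i = j then [:0, 1:] else if j = 0 then - [:s:] else - [:t:])"
    by (rule eq_matI) (simp_all add: char_poly_matrix_def col)
  then have "char_poly ?Q = ([:0, 1:] + [:t:])\<^sup>2 * ([:0, 1:]\<^sup>2 - 2 * [:t:] * [:0, 1:] - 3 * [:s:] * [:t:])"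
    unfolding char_poly_def by (simp only: det_four_eq_off_diagonal_columns)
  also have "\<dots> = [:t, 1:]\<^sup>2 * [:- 3 * s * t, - 2 * t, 1:]"
    by (simp add: power2_eq_square numeral_poly)
  finally have Q: "char_poly ?Q = [:t, 1:]\<^sup>2 * [:- 3 * s * t, - 2 * t, 1:]" .
  have len: "length ?ns = 4" and tot: "sum_list ?ns = a + 3 * b" by simp_all
  \<comment> \<open>There are at least four vertices, so the factor \<open>X\<^sup>4\<close> on the left can be cancelled.\<close>
  have "a + 3 * b = (a + 3 * b - 4) + 4" using a b by simp
  then have "[:0, 1:] ^ (a + 3 * b) = [:0, 1:] ^ (a + 3 * b - 4) * ([:0, 1:] ^ 4 :: real poly)"
    by (metis power_add)
  moreover have "char_poly (M2 G vs) * [:0, 1:] ^ 4 = [:0, 1:] ^ (a + 3 * b) * char_poly ?Q"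
    using char_poly_M2_complete_multipartite[OF G vs] unfolding len tot .
  ultimately have "char_poly (M2 G vs) * [:0, 1:] ^ 4
      = ([:0, 1:] ^ (a + 3 * b - 4) * ([:t, 1:]\<^sup>2 * [:- 3 * s * t, - 2 * t, 1:])) * [:0, 1:] ^ 4"
    unfolding Q by (simp only: ac_simps)
  then show ?thesis by (simp only: mult_right_cancel power_not_zero pCons_eq_0_iff one_neq_zero simp_thms)
qed

lemma part_masses_eq_iff:
  fixes a b :: nat
  assumes b: "b \<ge> 1"
  shows "9 * real a * (real b)\<^sup>2 = real b * (real a + 2 * real b)\<^sup>2 \<longleftrightarrow> a = b \<or> a = 4 * b"
proof -
  have "9 * real a * (real b)\<^sup>2 = real b * (real a + 2 * real b)\<^sup>2
      \<longleftrightarrow> real b * ((real a - real b) * (real a - 4 * real b)) = 0"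
    by (auto simp: power2_eq_square algebra_simps)
  also have "\<dots> \<longleftrightarrow> a = b \<or> a = 4 * b" using b by auto
  finally show ?thesis .
qed

text \<open>
  The roots of the quadratic are \<open>t + r\<close> and \<open>t - r\<close>, where \<open>r = sqrt (t\<^sup>2 + 3st) > t\<close>. Hence
  \<open>t - r < 0 < t + r\<close>, and the only possible coincidence among \<open>0\<close>, \<open>-t\<close> and these two is
  \<open>t - r = -t\<close>.
\<close>
lemma card_zero_and_quadratic_roots:
  fixes s t :: real
  assumes s: "s > 0" and t: "t > 0"
  shows "card {x. x = 0 \<or> x = - t \<or> x\<^sup>2 - 2 * t * x - 3 * s * t = 0} = 3 \<longleftrightarrow> s = t"
proof -
  define r where "r = sqrt (t\<^sup>2 + 3 * s * t)"
  have r2: "r\<^sup>2 = t\<^sup>2 + 3 * s * t" unfolding r_def using s t by simp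
  have rt: "r > t" unfolding r_def using s t by (intro real_less_rsqrt) simp
  have "x\<^sup>2 - 2 * t * x - 3 * s * t = (x - (t + r)) * (x - (t - r))" for x
    using r2 by (simp add: power2_eq_square algebra_simps)
  then have roots: "{x. x = 0 \<or> x = - t \<or> x\<^sup>2 - 2 * t * x - 3 * s * t = 0} = {0, - t, t + r, t - r}"
    by auto
  have "card {0, - t, t + r, t - r} = 3 \<longleftrightarrow> t - r = - t"
    using rt t by (cases "t - r = - t") (simp_all add: card_insert_if)
  also have "\<dots> \<longleftrightarrow> r = 2 * t" by auto
  also have "\<dots> \<longleftrightarrow> r\<^sup>2 = (2 * t)\<^sup>2" using rt t by (subst power2_eq_iff_nonneg) auto
  also have "\<dots> \<longleftrightarrow> 3 * t * (s - t) = 0"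
    unfolding r2 by (auto simp: power2_eq_square algebra_simps)
  also have "\<dots> \<longleftrightarrow> s = t" using t by simp
  finally show ?thesis unfolding roots .
qed

theorem proposition2p10:
  fixes G :: "('a, 'b) pre_digraph" and vs :: "'a list" and a b :: nat
  assumes "a \<ge> 1" and "b \<ge> 1"
    and "complete_multipartite_digraph [a, b, b, b] G"
    and "distinct vs" and "set vs = verts G"
  shows "(\<not> (a = 1 \<and> b = 1) \<longrightarrow> (card (spectrum (M2 G vs)) = 3 \<longleftrightarrow> a = b \<or> a = 4 * b)) \<and>
         (a = 4 * b \<longrightarrow>
           Spec (M2 G vs) = replicate_mset (7 * b - 4) 0
                            + {# 108 * real b ^ 3 #}
                            + replicate_mset 3 (- 36 * real b ^ 3))"
proof (intro conjI impI)
  define s where "s = 9 * real a * (real b)\<^sup>2"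
  define t where "t = real b * (real a + 2 * real b)\<^sup>2"
  have cp: "char_poly (M2 G vs)
      = [:0, 1:] ^ (a + 3 * b - 4) * ([:t, 1:]\<^sup>2 * [:- 3 * s * t, - 2 * t, 1:])"
    using char_poly_M2_one_part_and_three_equal[OF assms] by (simp add: s_def t_def)
  have pos: "s > 0" "t > 0" using assms(1,2) by (auto simp: s_def t_def)
  {
    assume "\<not> (a = 1 \<and> b = 1)"
    \<comment> \<open>Then the power of \<open>X\<close> in the characteristic polynomial is not constant, and \<open>0\<close> is a root.\<close>
    then have n: "a + 3 * b - 4 > 0" using assms(1,2) by linarith
    have "M2 G vs \<in> carrier_mat (length vs) (length vs)"
      by (simp add: M2_def weighted_adj_mat_def)
    then have "spectrum (M2 G vs) = {x. poly (char_poly (M2 G vs)) x = 0}"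
      by (rule spectrum_root_char_poly)
    also have "\<dots> = {x. x = 0 \<or> x = - t \<or> x\<^sup>2 - 2 * t * x - 3 * s * t = 0}"
    proof -
      have "poly (char_poly (M2 G vs)) x
          = x ^ (a + 3 * b - 4) * ((t + x)\<^sup>2 * (x\<^sup>2 - 2 * t * x - 3 * s * t))" for x
        unfolding cp by (simp add: power2_eq_square algebra_simps)
      moreover have "t + x = 0 \<longleftrightarrow> x = - t" for x by auto
      ultimately show ?thesis using n by simp
    qed
    finally show "card (spectrum (M2 G vs)) = 3 \<longleftrightarrow> a = b \<or> a = 4 * b"
      using card_zero_and_quadratic_roots[OF pos] part_masses_eq_iff[OF assms(2), of a]
      by (simp add: s_def t_def)
  }
  {
    assume a4: "a = 4 * b"
    have st: "s = t" using part_masses_eq_iff[OF assms(2), of a] a4 by (simp add: s_def t_def)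
    have t: "t = 36 * real b ^ 3"
      unfolding t_def a4 by (simp add: power2_eq_square power3_eq_cube)
    have "[:- 3 * s * t, - 2 * t, 1:] = [:t, 1:] * [:- (3 * t), 1:]"
      by (simp add: st)
    then have "char_poly (M2 G vs) = [:0, 1:] ^ (7 * b - 4) * [:t, 1:] ^ 3 * [:- (3 * t), 1:]"
      unfolding cp by (simp add: a4 power2_eq_square power3_eq_cube algebra_simps del: mult_pCons_left mult_pCons_right)
    then have "Spec (M2 G vs) = replicate_mset (7 * b - 4) 0 + replicate_mset 3 (- t) + {#3 * t#}"
      unfolding Spec_def by (simp add: proots_mult proots_power del: mult_pCons_left mult_pCons_right)
    then show "Spec (M2 G vs) = replicate_mset (7 * b - 4) 0
        + {# 108 * real b ^ 3 #} + replicate_mset 3 (- 36 * real b ^ 3)"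
      by (simp add: t)
  }
qed

end
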